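(* The Gauss hypergeometric functions satisfy the identity (of power series in $x$) $${}_2F_1\left[\begin{matrix}\frac13,\frac13\\ \frac23\end{matrix}\Big|x\right]\,{}_2F_1\left[\begin{matrix}-\frac13,\frac23\\ \frac13\end{matrix}\Big|x\right]+\frac{x}{2}\,{}_2F_1\left[\begin{matrix}\frac23,\frac23\\ \frac43\end{matrix}\Big|x\right]\,{}_2F_1\left[\begin{matrix}\frac13,\frac43\\ \frac53\end{matrix}\Big|x\right]=1.$$
   Context: ${}_2F_1\left[\begin{matrix}a,b\\c\end{matrix}\Big|x\right]=\sum_{n\ge0}\frac{(a)_n(b)_n}{(c)_n}\frac{x^n}{n!}$, where $(\alpha)_n=\Gamma(\alpha+n)/\Gamma(\alpha)=\alpha(\alpha+1)\cdots(\alpha+n-1)$. *)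

theory Defs
  imports Complex_Main "HOL-Computational_Algebra.Formal_Power_Series"
begin

(* The last argument 1 of fps_hypergeo is a scaling factor: it multiplies the
   n-th coefficient by its n-th power. *)
abbreviation hyp2F1 :: "'a \<Rightarrow> 'a \<Rightarrow> 'a \<Rightarrow> 'a :: field_char_0 fps" where
  "hyp2F1 a b c \<equiv> fps_hypergeo [a, b] [c] 1"

lemma hyp2F1_nth:
  "fps_nth (hyp2F1 a b c) n = pochhammer a n * pochhammer b n / pochhammer c n / fact n"
  by simp

end

theory Submission
  imports Defs
begin

(* Write F, G, H, K for the four series, in the order of the statement.  F and x^(1/3) H span the
   solutions of one hypergeometric equation, so their Wronskian, multiplied by x^(2/3) (1 - x), is
   constant; this is W = (1 - x) (F (H + 3 x H') - 3 x F' H) = 1.  The contiguity relations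
   G = (1 - x) (H + 3 x H') - x H and K = 2 F - 6 (1 - x) F' turn F G + (x/2) H K into W. *)

lemma pochhammer_neq_0I:
  fixes c :: "'a::field_char_0"
  assumes "\<And>n. c + of_nat n \<noteq> 0"
  shows "pochhammer c n \<noteq> 0"
  using assms by (metis add_eq_0_iff2 pochhammer_eq_0_iff)

text \<open>The ratio of consecutive terms, multiplied out. Since no \<open>c + of_nat n\<close>
  vanishes, no denominator falls under the convention \<open>x / 0 = 0\<close>.\<close>

lemma hyp2F1_nth_Suc:
  fixes a b c :: "'a::field_char_0"
  assumes "\<And>n. c + of_nat n \<noteq> 0"
  shows "(1 + of_nat n) * (c + of_nat n) * fps_nth (hyp2F1 a b c) (Suc n)
    = (a + of_nat n) * (b + of_nat n) * fps_nth (hyp2F1 a b c) n"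
proof -
  have "(1 + of_nat n :: 'a) \<noteq> 0"
    using of_nat_neq_0[of n, where 'a='a] by simp
  moreover have "pochhammer c n \<noteq> 0"
    using assms by (rule pochhammer_neq_0I)
  moreover have "fact (Suc n) = (1 + of_nat n) * (fact n :: 'a)"
    by (simp add: algebra_simps)
  ultimately show ?thesis
    using assms[of n] by (simp add: pochhammer_Suc divide_simps del: fact_Suc)
qed

lemma hyp2F1_ode:
  fixes a b c :: "'a::field_char_0"
  assumes "\<And>n. c + of_nat n \<noteq> 0"
  defines "F \<equiv> hyp2F1 a b c"
  shows "fps_X * (1 - fps_X) * fps_deriv (fps_deriv F)
    = fps_const (a * b) * F - (fps_const c - fps_const (a + b + 1) * fps_X) * fps_deriv F"
proof -
  have rec: "(1 + of_nat n) * (c + of_nat n) * fps_nth F (Suc n)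
      = (a + of_nat n) * (b + of_nat n) * fps_nth F n" for n
    unfolding F_def by (rule hyp2F1_nth_Suc) (fact assms)
  \<comment> \<open>The equation is sorted by index: the left side involves only coefficient n+1 of
    \<open>F\<close>, with n(n+1) + c(n+1) = (n+1)(c+n); the right side only coefficient n, with
    n(n-1) + (a+b+1)n + ab = (a+n)(b+n).\<close>
  have "fps_X * fps_deriv (fps_deriv F) + fps_const c * fps_deriv F
      = fps_X * (fps_X * fps_deriv (fps_deriv F)) + fps_const (a + b + 1) * (fps_X * fps_deriv F)
        + fps_const (a * b) * F" (is "?L = ?R")
  proof (rule fps_ext)
    fix n
    have "fps_nth ?L n = (1 + of_nat n) * (c + of_nat n) * fps_nth F (Suc n)"
      by (cases n) (simp_all add: algebra_simps del: fps_hypergeo_nth)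
    moreover have "fps_nth ?R n = (a + of_nat n) * (b + of_nat n) * fps_nth F n"
    proof (cases n)
      case (Suc m)
      then show ?thesis by (cases m) (simp_all add: algebra_simps)
    qed simp
    ultimately show "fps_nth ?L n = fps_nth ?R n" using rec[of n] by simp
  qed
  then show ?thesis by (simp add: algebra_simps)
qed

lemma hyp2F1_contiguous_G:
  fixes H :: "'a::field_char_0 fps"
  defines "H \<equiv> hyp2F1 (2/3) (2/3) (4/3)"
  shows "hyp2F1 (-1/3) (2/3) (1/3) = (1 - fps_X) * (H + 3 * fps_X * fps_deriv H) - fps_X * H"
    (is "?G = _")
proof -
  \<comment> \<open>The field has no order, so each factor is seen to be nonzero as the image of a
    successor.\<close>
  have nz: "(4 + 3 * of_nat n :: 'a) \<noteq> 0" "(1 + of_nat n :: 'a) \<noteq> 0" for n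
    using of_nat_neq_0[of "3*n+3", where 'a='a] of_nat_neq_0[of n, where 'a='a] by (simp_all add: algebra_simps)
  have p4: "pochhammer (4/3 :: 'a) n \<noteq> 0" for n
    by (rule pochhammer_neq_0I) (use nz(1) in \<open>simp add: field_simps\<close>)
  \<comment> \<open>Splitting off the first factor turns the parameters 1/3 and -1/3 into the
    parameters 4/3 and 2/3 of \<open>H\<close>, so coefficient m+1 of \<open>?G\<close> is a
    rational multiple of coefficient m of \<open>H\<close>.\<close>
  have p13: "pochhammer (1/3 :: 'a) (Suc n) = pochhammer (4/3) n / 3" for n
    by (simp add: pochhammer_rec)
  have pm: "pochhammer (-(1/3) :: 'a) (Suc n) = - pochhammer (2/3) n / 3" for n
    by (simp add: pochhammer_rec)
  \<comment> \<open>Regrouped through the Euler operator x d/dx, which multiplies the n-th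
    coefficient by n.\<close>
  have "?G = H + 3 * (fps_X * fps_deriv H) - fps_X * (2 * H + 3 * (fps_X * fps_deriv H))"
  proof (rule fps_ext)
    fix n
    show "fps_nth ?G n = fps_nth (H + 3 * (fps_X * fps_deriv H)
        - fps_X * (2 * H + 3 * (fps_X * fps_deriv H))) n"
    proof (cases n)
      case 0
      then show ?thesis by (simp add: H_def)
    next
      case (Suc m)
      define P :: 'a where "P = pochhammer (2/3) m"
      define Q :: 'a where "Q = pochhammer (4/3) m"
      define f :: 'a where "f = fact m"
      define x :: 'a where "x = of_nat m"
      have nz': "4 + 3 * x \<noteq> 0" "1 + x \<noteq> 0" "Q \<noteq> 0" "f \<noteq> 0"
        unfolding x_def Q_def f_def using nz p4 by auto
      have fS: "fact (Suc m) = (1 + of_nat m) * (fact m :: 'a)"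
        by (simp add: algebra_simps)
      have h: "fps_nth H m = P * P / (Q * f)"
        by (simp add: H_def P_def Q_def f_def)
      have hS: "fps_nth H (Suc m) = P * (2/3 + x) * (P * (2/3 + x)) / (Q * (4/3 + x) * ((1 + x) * f))"
        by (simp add: H_def pochhammer_Suc fS P_def Q_def f_def x_def del: fact_Suc)
      have g: "fps_nth ?G (Suc m) = (- P / 3) * (P * (2/3 + x)) / (Q / 3 * ((1 + x) * f))"
        by (simp add: p13 pm pochhammer_Suc[of "2/3"] fS P_def Q_def f_def x_def del: fact_Suc)
      have l: "fps_nth (fps_X * fps_deriv H) m = x * fps_nth H m"
        by (cases m) (simp_all add: x_def)
      have "fps_nth (H + 3 * (fps_X * fps_deriv H) - fps_X * (2 * H + 3 * (fps_X * fps_deriv H))) (Suc m)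
         = (4 + 3 * x) * fps_nth H (Suc m) - (2 + 3 * x) * fps_nth H m"
        using l by (simp add: numeral_fps_const algebra_simps x_def)
      also have "\<dots> = fps_nth ?G (Suc m)"
        unfolding g h hS using nz' by (simp add: divide_simps) algebra
      finally show ?thesis using Suc by simp
    qed
  qed
  also have "\<dots> = (1 - fps_X) * (H + 3 * fps_X * fps_deriv H) - fps_X * H"
    by (simp add: algebra_simps)
  finally show ?thesis .
qed

lemma hyp2F1_contiguous_K:
  fixes F :: "'a::field_char_0 fps"
  defines "F \<equiv> hyp2F1 (1/3) (1/3) (2/3)"
  shows "hyp2F1 (1/3) (4/3) (5/3) = 2 * F - 6 * (1 - fps_X) * fps_deriv F"
    (is "?K = _")
proof -
  have nz: "(2 + 3 * of_nat n :: 'a) \<noteq> 0" for n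
    using of_nat_neq_0[of "3*n+1", where 'a='a] by (simp add: algebra_simps)
  have c: "(2/3 + of_nat n :: 'a) \<noteq> 0" for n
    using nz[of n] by (simp add: field_simps)
  have p2: "pochhammer (2/3 :: 'a) n \<noteq> 0" for n
    using c by (rule pochhammer_neq_0I)
  \<comment> \<open>Both sides are a(a+1)...(a+n), peeled from opposite ends.\<close>
  have shift: "a * pochhammer (a + 1) n = (a + of_nat n) * pochhammer a n" for a :: 'a and n
    by (metis pochhammer_rec pochhammer_rec')
  have p4: "pochhammer (4/3 :: 'a) n = (1 + 3 * of_nat n) * pochhammer (1/3) n" for n
  proof -
    have "pochhammer (4/3 :: 'a) n = 3 * ((1/3 + of_nat n) * pochhammer (1/3) n)"
      using shift[of "1/3" n] by simp
    then show ?thesis by (simp add: algebra_simps)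
  qed
  have p5: "pochhammer (5/3 :: 'a) n = (2 + 3 * of_nat n) / 2 * pochhammer (2/3) n" for n
  proof -
    have "pochhammer (5/3 :: 'a) n = 3/2 * ((2/3 + of_nat n) * pochhammer (2/3) n)"
      using shift[of "2/3" n] by (simp add: ac_simps)
    also have "\<dots> = (2 + 3 * of_nat n) / 2 * pochhammer (2/3) n"
      by (simp add: field_simps)
    finally show ?thesis .
  qed
  have "?K = 2 * F - 6 * fps_deriv F + 6 * (fps_X * fps_deriv F)"
  proof (rule fps_ext)
    fix n
    define x :: 'a where "x = of_nat n"
    \<comment> \<open>This eliminates coefficient n+1 of \<open>F\<close>, which enters through
      \<open>fps_deriv F\<close>; what remains is a rational identity in x.\<close>
    have rec: "(1 + x) * (2/3 + x) * fps_nth F (Suc n) = (1/3 + x) * (1/3 + x) * fps_nth F n"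
      unfolding F_def x_def by (rule hyp2F1_nth_Suc) (rule c)
    have k: "fps_nth ?K n = 2 * (1 + 3 * x) / (2 + 3 * x) * fps_nth F n"
      using nz[of n] p2[of n] by (simp add: F_def p4 p5 x_def field_simps)
    have l: "fps_nth (fps_X * fps_deriv F) n = x * fps_nth F n"
      by (cases n) (simp_all add: x_def)
    have "fps_nth (2 * F - 6 * fps_deriv F + 6 * (fps_X * fps_deriv F)) n
      = (2 + 6 * x) * fps_nth F n - 6 * ((1 + x) * fps_nth F (Suc n))"
      using l by (simp add: numeral_fps_const algebra_simps x_def)
    also have "\<dots> = fps_nth ?K n"
      unfolding k using rec nz[of n, folded x_def] by (simp add: divide_simps) algebra
    finally show "fps_nth ?K n = fps_nth (2 * F - 6 * fps_deriv F + 6 * (fps_X * fps_deriv F)) n" ..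
  qed
  then show ?thesis by (simp add: algebra_simps)
qed

text \<open>The factor \<open>H + 3 * fps_X * fps_deriv H\<close> is 3 x^(2/3) times the derivative
  of x^(1/3) H, so fractional powers cancel and everything stays a power series. The two
  differential equations make the derivative vanish.\<close>

lemma hyp2F1_wronskian:
  fixes F H :: "'a::field_char_0 fps"
  defines "F \<equiv> hyp2F1 (1/3) (1/3) (2/3)" and "H \<equiv> hyp2F1 (2/3) (2/3) (4/3)"
  shows "(1 - fps_X) * (F * (H + 3 * fps_X * fps_deriv H) - 3 * fps_X * fps_deriv F * H) = 1"
    (is "?W = 1")
proof -
  have nz: "(2/3 + of_nat n :: 'a) \<noteq> 0" "(4/3 + of_nat n :: 'a) \<noteq> 0" for n
    using of_nat_neq_0[of "3*n+1", where 'a='a] of_nat_neq_0[of "3*n+3", where 'a='a]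
    by (simp_all add: field_simps)
  let ?X = "fps_X :: 'a fps"
  define F1 H1 F2 H2 where d: "F1 = fps_deriv F" "H1 = fps_deriv H" "F2 = fps_deriv F1" "H2 = fps_deriv H1"
  \<comment> \<open>To \<open>algebra\<close> each \<open>fps_const\<close> is an opaque symbol;
    these equations let it clear denominators.\<close>
  have nine: "9 * fps_const (1/9 :: 'a) = 1" "9 * fps_const (4/9 :: 'a) = 4"
    "9 * fps_const (2/3 :: 'a) = 6" "9 * fps_const (5/3 :: 'a) = 15"
    "9 * fps_const (4/3 :: 'a) = 12" "9 * fps_const (7/3 :: 'a) = 21"
    by (simp_all add: numeral_fps_const)
  have "?X * (1 - ?X) * F2 = fps_const (1/9) * F - (fps_const (2/3) - fps_const (5/3) * ?X) * F1"
    using hyp2F1_ode[of "2/3::'a" "1/3" "1/3"] nz(1) by (simp add: F_def d)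
  then have F: "9 * ?X * (1 - ?X) * F2 = F - (6 - 15 * ?X) * F1"
    using nine by algebra
  have "?X * (1 - ?X) * H2 = fps_const (4/9) * H - (fps_const (4/3) - fps_const (7/3) * ?X) * H1"
    using hyp2F1_ode[of "4/3::'a" "2/3" "2/3"] nz(2) by (simp add: H_def d)
  then have H: "9 * ?X * (1 - ?X) * H2 = 4 * H - (12 - 21 * ?X) * H1"
    using nine by algebra
  have "fps_deriv ?W = - (F * (H + 3 * ?X * H1) - 3 * ?X * F1 * H)
    + (1 - ?X) * (4 * F * H1 + 3 * ?X * F * H2 - 2 * F1 * H - 3 * ?X * F2 * H)"
    by (simp add: d algebra_simps)
  \<comment> \<open>Tripling turns the second-order terms into \<open>9 * ?X * (1 - ?X)\<close>
    times \<open>F * H2 - F2 * H\<close>, which \<open>F\<close> and \<open>H\<close> replace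
    without division.\<close>
  then have "3 * fps_deriv ?W = 0"
    using F H by algebra
  moreover have "(3 :: 'a fps) \<noteq> 0"
    by (simp add: numeral_fps_const)
  ultimately have "fps_deriv ?W = 0"
    by (simp only: mult_eq_0_iff simp_thms)
  \<comment> \<open>The constant term is the product of those of \<open>F\<close> and
    \<open>H\<close>, both 1.\<close>
  then have "?W = fps_const (fps_nth ?W 0)"
    using fps_deriv_eq_0_iff by blast
  then show ?thesis by (simp add: F_def H_def)
qed

theorem corollary2p4:
  shows "hyp2F1 (1/3) (1/3) (2/3) * hyp2F1 (-1/3) (2/3) (1/3)
       + fps_const (1/2) * fps_X * (hyp2F1 (2/3) (2/3) (4/3) * hyp2F1 (1/3) (4/3) (5/3))
       = (1 :: complex fps)"
proof -
  have "2 * fps_const (1/2 :: complex) = 1"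
    by (simp add: numeral_fps_const)
  \<comment> \<open>The term -x F H from G cancels x F H from (x/2) H K, which leaves W.\<close>
  then show ?thesis
    unfolding hyp2F1_contiguous_G hyp2F1_contiguous_K
    using hyp2F1_wronskian[where 'a=complex] by algebra
qed

end
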